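(* Let $\tilde M$ be a module over a right-symmetric algebra $A$ and $M\subseteq\tilde M$ a submodule. Suppose $\tilde m\in\tilde M$ satisfies $(\tilde m,a,b):=\tilde m\circ(a\circ b)-(\tilde m\circ a)\circ b\in M$ for all $a,b\in A$. Then the 2-cochain $\psi_{\tilde m}\in C^2(A,M)$ defined by $$\psi_{\tilde m}(a,b)=\tilde m\circ(a\circ b)-(\tilde m\circ a)\circ b$$ is a symmetric right-symmetric 2-cocycle, i.e. $\psi_{\tilde m}(a,b)=\psi_{\tilde m}(b,a)$ and $d_{rsym}\psi_{\tilde m}=0$. If moreover $\tilde m\circ a\in M$ for all $a\in A$, then $[\psi_{\tilde m}]=[\phi_{\tilde m}]$ in $H^2_{rsym}(A,M)$, where $\phi_{\tilde m}(a,b)=a\circ(\tilde m\circ b)$.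
   Context: A right-symmetric algebra over a field $\mathcal K$ is a vector space $A$ with bilinear product $\circ$ satisfying $a\circ(b\circ c)-(a\circ b)\circ c=a\circ(c\circ b)-(a\circ c)\circ b$; $[a,b]=a\circ b-b\circ a$. An $A$-module is a vector space $M$ with bilinear actions $m\circ a$, $a\circ m$ such that $m\circ[a,b]=(m\circ a)\circ b-(m\circ b)\circ a$ and $(a\circ m)\circ b-a\circ(m\circ b)-(a\circ b)\circ m+a\circ(b\circ m)=0$. For $\omega\in C^1(A,M)=\mathrm{Hom}(A,M)$, $d_{rsym}\omega(a,b)=a\circ\omega(b)-\omega(a\circ b)+\omega(a)\circ b$. For $\psi\in C^2(A,M)=\mathrm{Hom}(A\otimes A,M)$, $$d_{rsym}\psi(a,b,c)=a\circ\psi(b,c)-a\circ\psi(c,b)-\psi(a\circ b,c)+\psi(a\circ c,b)+\psi(a,[b,c])-\psi(a,b)\circ c+\psi(a,c)\circ b.$$ $H^2_{rsym}(A,M)=\{\psi\in C^2(A,M):d_{rsym}\psi=0\}/\{d_{rsym}\omega:\omega\in C^1(A,M)\}$, and $[\psi]$ is the class of $\psi$. *)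

theory Defs
  imports Complex_Main
begin

definition bilinear_over ::
  "('k::field \<Rightarrow> 'a::ab_group_add \<Rightarrow> 'a) \<Rightarrow> ('k \<Rightarrow> 'b::ab_group_add \<Rightarrow> 'b) \<Rightarrow>
   ('k \<Rightarrow> 'c::ab_group_add \<Rightarrow> 'c) \<Rightarrow> ('a \<Rightarrow> 'b \<Rightarrow> 'c) \<Rightarrow> bool"
where
  "bilinear_over sA sB sC f \<longleftrightarrow>
     (\<forall>b. Vector_Spaces.linear sA sC (\<lambda>a. f a b)) \<and> (\<forall>a. Vector_Spaces.linear sB sC (f a))"

locale right_symmetric_algebra = vector_space sA
  for sA :: "'k::field \<Rightarrow> 'a::ab_group_add \<Rightarrow> 'a" +
  fixes mul :: "'a \<Rightarrow> 'a \<Rightarrow> 'a" (infixl \<open>\<cdot>\<close> 70)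
  assumes mul_bilinear: "bilinear_over sA sA sA mul"
    and right_symmetric:
      "a \<cdot> (b \<cdot> c) - (a \<cdot> b) \<cdot> c = a \<cdot> (c \<cdot> b) - (a \<cdot> c) \<cdot> b"

definition commutator :: "('a \<Rightarrow> 'a \<Rightarrow> 'a::ab_group_add) \<Rightarrow> 'a \<Rightarrow> 'a \<Rightarrow> 'a" where
  "commutator mul a b = mul a b - mul b a"

(* lact a m is the left action of a on m, ract m a the right action. *)
locale right_symmetric_module =
  right_symmetric_algebra sA mul + M: vector_space sM
  for sA :: "'k::field \<Rightarrow> 'a::ab_group_add \<Rightarrow> 'a"
    and mul :: "'a \<Rightarrow> 'a \<Rightarrow> 'a" (infixl \<open>\<cdot>\<close> 70)
    and sM :: "'k \<Rightarrow> 'm::ab_group_add \<Rightarrow> 'm" +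
  fixes lact :: "'a \<Rightarrow> 'm \<Rightarrow> 'm" (infixl \<open>\<triangleright>\<close> 70)
    and ract :: "'m \<Rightarrow> 'a \<Rightarrow> 'm" (infixl \<open>\<triangleleft>\<close> 70)
  assumes lact_bilinear: "bilinear_over sA sM sM lact"
    and ract_bilinear: "bilinear_over sM sA sM ract"
    and ract_commutator: "m \<triangleleft> commutator mul a b = (m \<triangleleft> a) \<triangleleft> b - (m \<triangleleft> b) \<triangleleft> a"
    and lact_ract: "(a \<triangleright> m) \<triangleleft> b - a \<triangleright> (m \<triangleleft> b) - (a \<cdot> b) \<triangleright> m + a \<triangleright> (b \<triangleright> m) = 0"

definition rsym_submodule ::
  "('k::field \<Rightarrow> 'm::ab_group_add \<Rightarrow> 'm) \<Rightarrow> ('a \<Rightarrow> 'm \<Rightarrow> 'm) \<Rightarrow> ('m \<Rightarrow> 'a \<Rightarrow> 'm) \<Rightarrow> 'm set \<Rightarrow> bool"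
where
  "rsym_submodule sM lact ract M \<longleftrightarrow>
     module.subspace sM M \<and> (\<forall>a. \<forall>m\<in>M. lact a m \<in> M \<and> ract m a \<in> M)"

(* The coefficient module M is a submodule of a module on the whole type 'm (possibly UNIV),
   with the restricted actions.  Hom(A, M) and Hom(A (x) A, M) are the linear, respectively
   bilinear, maps into 'm all of whose values lie in M. *)

definition rsym_C1 ::
  "('k::field \<Rightarrow> 'a::ab_group_add \<Rightarrow> 'a) \<Rightarrow> ('k \<Rightarrow> 'm::ab_group_add \<Rightarrow> 'm) \<Rightarrow> 'm set \<Rightarrow>
   ('a \<Rightarrow> 'm) set"
where
  "rsym_C1 sA sM M = {\<omega>. Vector_Spaces.linear sA sM \<omega> \<and> (\<forall>a. \<omega> a \<in> M)}"

definition rsym_C2 ::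
  "('k::field \<Rightarrow> 'a::ab_group_add \<Rightarrow> 'a) \<Rightarrow> ('k \<Rightarrow> 'm::ab_group_add \<Rightarrow> 'm) \<Rightarrow> 'm set \<Rightarrow>
   ('a \<Rightarrow> 'a \<Rightarrow> 'm) set"
where
  "rsym_C2 sA sM M = {\<psi>. bilinear_over sA sA sM \<psi> \<and> (\<forall>a b. \<psi> a b \<in> M)}"

definition rsym_d1 ::
  "('a \<Rightarrow> 'a \<Rightarrow> 'a::ab_group_add) \<Rightarrow> ('a \<Rightarrow> 'm \<Rightarrow> 'm) \<Rightarrow> ('m \<Rightarrow> 'a \<Rightarrow> 'm) \<Rightarrow>
   ('a \<Rightarrow> 'm::ab_group_add) \<Rightarrow> 'a \<Rightarrow> 'a \<Rightarrow> 'm"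
where
  "rsym_d1 mul lact ract \<omega> a b = lact a (\<omega> b) - \<omega> (mul a b) + ract (\<omega> a) b"

definition rsym_d2 ::
  "('a \<Rightarrow> 'a \<Rightarrow> 'a::ab_group_add) \<Rightarrow> ('a \<Rightarrow> 'm \<Rightarrow> 'm) \<Rightarrow> ('m \<Rightarrow> 'a \<Rightarrow> 'm) \<Rightarrow>
   ('a \<Rightarrow> 'a \<Rightarrow> 'm::ab_group_add) \<Rightarrow> 'a \<Rightarrow> 'a \<Rightarrow> 'a \<Rightarrow> 'm"
where
  "rsym_d2 mul lact ract \<psi> a b c =
     lact a (\<psi> b c) - lact a (\<psi> c b) - \<psi> (mul a b) c + \<psi> (mul a c) b
     + \<psi> a (commutator mul b c) - ract (\<psi> a b) c + ract (\<psi> a c) b"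

definition rsym_Z2 ::
  "('k::field \<Rightarrow> 'a::ab_group_add \<Rightarrow> 'a) \<Rightarrow> ('a \<Rightarrow> 'a \<Rightarrow> 'a) \<Rightarrow> ('k \<Rightarrow> 'm::ab_group_add \<Rightarrow> 'm) \<Rightarrow>
   ('a \<Rightarrow> 'm \<Rightarrow> 'm) \<Rightarrow> ('m \<Rightarrow> 'a \<Rightarrow> 'm) \<Rightarrow> 'm set \<Rightarrow> ('a \<Rightarrow> 'a \<Rightarrow> 'm) set"
where
  "rsym_Z2 sA mul sM lact ract M =
     {\<psi> \<in> rsym_C2 sA sM M. \<forall>a b c. rsym_d2 mul lact ract \<psi> a b c = 0}"

definition rsym_B2 ::
  "('k::field \<Rightarrow> 'a::ab_group_add \<Rightarrow> 'a) \<Rightarrow> ('a \<Rightarrow> 'a \<Rightarrow> 'a) \<Rightarrow> ('k \<Rightarrow> 'm::ab_group_add \<Rightarrow> 'm) \<Rightarrow>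
   ('a \<Rightarrow> 'm \<Rightarrow> 'm) \<Rightarrow> ('m \<Rightarrow> 'a \<Rightarrow> 'm) \<Rightarrow> 'm set \<Rightarrow> ('a \<Rightarrow> 'a \<Rightarrow> 'm) set"
where
  "rsym_B2 sA mul sM lact ract M = rsym_d1 mul lact ract ` rsym_C1 sA sM M"

definition rsym_cohomologous ::
  "('k::field \<Rightarrow> 'a::ab_group_add \<Rightarrow> 'a) \<Rightarrow> ('a \<Rightarrow> 'a \<Rightarrow> 'a) \<Rightarrow> ('k \<Rightarrow> 'm::ab_group_add \<Rightarrow> 'm) \<Rightarrow>
   ('a \<Rightarrow> 'm \<Rightarrow> 'm) \<Rightarrow> ('m \<Rightarrow> 'a \<Rightarrow> 'm) \<Rightarrow> 'm set \<Rightarrow>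
   (('a \<Rightarrow> 'a \<Rightarrow> 'm) \<times> ('a \<Rightarrow> 'a \<Rightarrow> 'm)) set"
where
  "rsym_cohomologous sA mul sM lact ract M =
     {(\<psi>, \<chi>). \<psi> \<in> rsym_Z2 sA mul sM lact ract M \<and> \<chi> \<in> rsym_Z2 sA mul sM lact ract M \<and>
        (\<lambda>a b. \<psi> a b - \<chi> a b) \<in> rsym_B2 sA mul sM lact ract M}"

definition rsym_H2 ::
  "('k::field \<Rightarrow> 'a::ab_group_add \<Rightarrow> 'a) \<Rightarrow> ('a \<Rightarrow> 'a \<Rightarrow> 'a) \<Rightarrow> ('k \<Rightarrow> 'm::ab_group_add \<Rightarrow> 'm) \<Rightarrow>
   ('a \<Rightarrow> 'm \<Rightarrow> 'm) \<Rightarrow> ('m \<Rightarrow> 'a \<Rightarrow> 'm) \<Rightarrow> 'm set \<Rightarrow> ('a \<Rightarrow> 'a \<Rightarrow> 'm) set set"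
where
  "rsym_H2 sA mul sM lact ract M =
     rsym_Z2 sA mul sM lact ract M // rsym_cohomologous sA mul sM lact ract M"

(* Meaningful only for cocycles: for any other cochain the class is empty. *)
definition rsym_class ::
  "('k::field \<Rightarrow> 'a::ab_group_add \<Rightarrow> 'a) \<Rightarrow> ('a \<Rightarrow> 'a \<Rightarrow> 'a) \<Rightarrow> ('k \<Rightarrow> 'm::ab_group_add \<Rightarrow> 'm) \<Rightarrow>
   ('a \<Rightarrow> 'm \<Rightarrow> 'm) \<Rightarrow> ('m \<Rightarrow> 'a \<Rightarrow> 'm) \<Rightarrow> 'm set \<Rightarrow> ('a \<Rightarrow> 'a \<Rightarrow> 'm) \<Rightarrow> ('a \<Rightarrow> 'a \<Rightarrow> 'm) set"
where
  "rsym_class sA mul sM lact ract M \<psi> = rsym_cohomologous sA mul sM lact ract M `` {\<psi>}"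

definition psi_cochain ::
  "('a \<Rightarrow> 'a \<Rightarrow> 'a) \<Rightarrow> ('m \<Rightarrow> 'a \<Rightarrow> 'm::ab_group_add) \<Rightarrow> 'm \<Rightarrow> 'a \<Rightarrow> 'a \<Rightarrow> 'm"
where
  "psi_cochain mul ract m a b = ract m (mul a b) - ract (ract m a) b"

definition phi_cochain ::
  "('a \<Rightarrow> 'm \<Rightarrow> 'm) \<Rightarrow> ('m \<Rightarrow> 'a \<Rightarrow> 'm) \<Rightarrow> 'm \<Rightarrow> 'a \<Rightarrow> 'a \<Rightarrow> 'm"
where
  "phi_cochain lact ract m a b = lact a (ract m b)"

end

theory Submission
  imports Defs
begin

text \<open>
  Work first in the ambient module and let \<open>\<omega>(a) = m \<triangleleft> a\<close>.  By definition
  \<open>(d\<^sub>1 \<omega>)(a, b) = a \<triangleright> (m \<triangleleft> b) - m \<triangleleft> (a \<cdot> b) + (m \<triangleleft> a) \<triangleleft> b\<close>, that is,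
  \<open>\<psi>\<^sub>m = \<phi>\<^sub>m - d\<^sub>1 \<omega>\<close>.  So \<open>\<psi>\<^sub>m\<close> is a cocycle as soon as \<open>\<phi>\<^sub>m\<close> is one, because
  \<open>d\<^sub>2\<close> is additive and \<open>d\<^sub>2 \<circ> d\<^sub>1 = 0\<close> (lemma \<open>rsym_d2_d1\<close>).  That \<open>\<phi>\<^sub>m\<close> is a
  cocycle (lemma \<open>rsym_d2_phi_cochain\<close>) follows by moving a right action past a left one
  with the axiom \<open>lact_ract\<close>: what remains is \<open>a\<close> acting on the relation
  \<open>m \<triangleleft> [b, c] = (m \<triangleleft> b) \<triangleleft> c - (m \<triangleleft> c) \<triangleleft> b\<close>.  The same relation, rearranged, is the
  symmetry of \<open>\<psi>\<^sub>m\<close>.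

  It remains to see where the values lie.  Those of \<open>\<psi>\<^sub>m\<close> are in \<open>M\<close> by the assumption on
  associators.  If moreover all \<open>m \<triangleleft> a\<close> lie in \<open>M\<close>, then \<open>\<omega>\<close> is a
  1-cochain with values in \<open>M\<close> and so is \<open>-\<omega>\<close>, and \<open>\<psi>\<^sub>m - \<phi>\<^sub>m = d\<^sub>1 (-\<omega>)\<close> is a coboundary
  over \<open>M\<close>.
\<close>

lemma bilinear_over_iff:
  "bilinear_over sA sB sC f \<longleftrightarrow>
     vector_space sA \<and> vector_space sB \<and> vector_space sC \<and>
     (\<forall>x y b. f (x + y) b = f x b + f y b) \<and> (\<forall>r x b. f (sA r x) b = sC r (f x b)) \<and>
     (\<forall>a x y. f a (x + y) = f a x + f a y) \<and> (\<forall>r a x. f a (sB r x) = sC r (f a x))"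
  unfolding bilinear_over_def Vector_Spaces.linear_iff by blast

context right_symmetric_module
begin

lemma mul_add_left: "(x + y) \<cdot> b = x \<cdot> b + y \<cdot> b"
  and mul_scale_left: "sA r x \<cdot> b = sA r (x \<cdot> b)"
  and mul_add_right: "a \<cdot> (x + y) = a \<cdot> x + a \<cdot> y"
  and mul_scale_right: "a \<cdot> sA r x = sA r (a \<cdot> x)"
  using mul_bilinear unfolding bilinear_over_iff by blast+

lemma lact_add_left: "(a + b) \<triangleright> x = a \<triangleright> x + b \<triangleright> x"
  and lact_scale_left: "sA r a \<triangleright> x = sM r (a \<triangleright> x)"
  and lact_add_right: "a \<triangleright> (x + y) = a \<triangleright> x + a \<triangleright> y"
  and lact_scale_right: "a \<triangleright> sM r x = sM r (a \<triangleright> x)"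
  using lact_bilinear unfolding bilinear_over_iff by blast+

lemma ract_add_left: "(x + y) \<triangleleft> a = x \<triangleleft> a + y \<triangleleft> a"
  and ract_scale_left: "sM r x \<triangleleft> a = sM r (x \<triangleleft> a)"
  and ract_add_right: "x \<triangleleft> (a + b) = x \<triangleleft> a + x \<triangleleft> b"
  and ract_scale_right: "x \<triangleleft> sA r a = sM r (x \<triangleleft> a)"
  using ract_bilinear unfolding bilinear_over_iff by blast+

lemma mul_diff_right: "a \<cdot> (x - y) = a \<cdot> x - a \<cdot> y"
  using mul_add_right[of a "x - y" y] by (simp add: algebra_simps)

lemma lact_diff_right: "a \<triangleright> (x - y) = a \<triangleright> x - a \<triangleright> y"
  using lact_add_right[of a "x - y" y] by (simp add: algebra_simps)

lemma ract_diff_left: "(x - y) \<triangleleft> a = x \<triangleleft> a - y \<triangleleft> a"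
  using ract_add_left[of "x - y" y a] by (simp add: algebra_simps)

lemma ract_diff_right: "x \<triangleleft> (a - b) = x \<triangleleft> a - x \<triangleleft> b"
  using ract_add_right[of x "a - b" b] by (simp add: algebra_simps)

lemma rsym_d1_zero: "rsym_d1 (\<cdot>) (\<triangleright>) (\<triangleleft>) (\<lambda>_. 0) = (\<lambda>_ _. 0)"
  using lact_add_right[of _ 0 0] ract_add_left[of 0 0] by (simp add: rsym_d1_def fun_eq_iff)

lemma rsym_d1_diff:
  "rsym_d1 (\<cdot>) (\<triangleright>) (\<triangleleft>) (\<lambda>x. \<omega> x - \<eta> x) a b =
     rsym_d1 (\<cdot>) (\<triangleright>) (\<triangleleft>) \<omega> a b - rsym_d1 (\<cdot>) (\<triangleright>) (\<triangleleft>) \<eta> a b"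
  by (simp add: rsym_d1_def lact_diff_right ract_diff_left algebra_simps)

lemma rsym_d2_diff:
  "rsym_d2 (\<cdot>) (\<triangleright>) (\<triangleleft>) (\<lambda>x y. \<psi> x y - \<chi> x y) a b c =
     rsym_d2 (\<cdot>) (\<triangleright>) (\<triangleleft>) \<psi> a b c - rsym_d2 (\<cdot>) (\<triangleright>) (\<triangleleft>) \<chi> a b c"
  by (simp add: rsym_d2_def lact_diff_right ract_diff_left algebra_simps)

text \<open>
  After expansion the terms sort themselves by the argument of \<open>\<omega>\<close>.  Those in \<open>\<omega>(c)\<close> and
  in \<open>\<omega>(b)\<close> cancel by \<open>lact_ract\<close>, those in \<open>\<omega>(a)\<close> by \<open>ract_commutator\<close>, and the values of
  \<open>\<omega>\<close> at triple products cancel by right symmetry of the algebra, which linearity of \<open>\<omega>\<close>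
  transports to the module.
\<close>

lemma rsym_d2_d1:
  assumes "Vector_Spaces.linear sA sM \<omega>"
  shows "rsym_d2 (\<cdot>) (\<triangleright>) (\<triangleleft>) (rsym_d1 (\<cdot>) (\<triangleright>) (\<triangleleft>) \<omega>) a b c = 0"
proof -
  have \<omega>_add: "\<omega> (x + y) = \<omega> x + \<omega> y" for x y
    using assms by (simp add: Vector_Spaces.linear_iff)
  have \<omega>_diff: "\<omega> (x - y) = \<omega> x - \<omega> y" for x y
    using \<omega>_add[of "x - y" y] by (simp add: algebra_simps)
  have triple: "\<omega> (a \<cdot> (b \<cdot> c)) - \<omega> ((a \<cdot> b) \<cdot> c) = \<omega> (a \<cdot> (c \<cdot> b)) - \<omega> ((a \<cdot> c) \<cdot> b)"
    using right_symmetric[of a b c] by (metis \<omega>_diff)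
  have at_a: "\<omega> a \<triangleleft> (b \<cdot> c) - \<omega> a \<triangleleft> (c \<cdot> b) = (\<omega> a \<triangleleft> b) \<triangleleft> c - (\<omega> a \<triangleleft> c) \<triangleleft> b"
    using ract_commutator[of "\<omega> a" b c] by (simp add: commutator_def ract_diff_right)
  note at_b = lact_ract[of a "\<omega> b" c] and at_c = lact_ract[of a "\<omega> c" b]
  have "rsym_d2 (\<cdot>) (\<triangleright>) (\<triangleleft>) (rsym_d1 (\<cdot>) (\<triangleright>) (\<triangleleft>) \<omega>) a b c =
      ((a \<triangleright> \<omega> c) \<triangleleft> b - a \<triangleright> (\<omega> c \<triangleleft> b) - (a \<cdot> b) \<triangleright> \<omega> c + a \<triangleright> (b \<triangleright> \<omega> c))
    - ((a \<triangleright> \<omega> b) \<triangleleft> c - a \<triangleright> (\<omega> b \<triangleleft> c) - (a \<cdot> c) \<triangleright> \<omega> b + a \<triangleright> (c \<triangleright> \<omega> b))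
    + ((\<omega> a \<triangleleft> (b \<cdot> c) - \<omega> a \<triangleleft> (c \<cdot> b)) - ((\<omega> a \<triangleleft> b) \<triangleleft> c - (\<omega> a \<triangleleft> c) \<triangleleft> b))
    - ((\<omega> (a \<cdot> (b \<cdot> c)) - \<omega> ((a \<cdot> b) \<cdot> c)) - (\<omega> (a \<cdot> (c \<cdot> b)) - \<omega> ((a \<cdot> c) \<cdot> b)))"
    by (simp add: rsym_d2_def rsym_d1_def commutator_def \<omega>_diff mul_diff_right
        lact_add_right lact_diff_right ract_add_left ract_diff_left ract_diff_right algebra_simps)
  also have "\<dots> = 0"
    unfolding at_b at_c at_a triple by simp
  finally show ?thesis .
qed

lemma rsym_d2_phi_cochain: "rsym_d2 (\<cdot>) (\<triangleright>) (\<triangleleft>) (phi_cochain (\<triangleright>) (\<triangleleft>) m) a b c = 0"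
proof -
  have comm: "a \<triangleright> (m \<triangleleft> commutator (\<cdot>) b c) = a \<triangleright> ((m \<triangleleft> b) \<triangleleft> c) - a \<triangleright> ((m \<triangleleft> c) \<triangleleft> b)"
    by (simp add: ract_commutator lact_diff_right)
  have "rsym_d2 (\<cdot>) (\<triangleright>) (\<triangleleft>) (phi_cochain (\<triangleright>) (\<triangleleft>) m) a b c =
      ((a \<triangleright> (m \<triangleleft> c)) \<triangleleft> b - a \<triangleright> ((m \<triangleleft> c) \<triangleleft> b) - (a \<cdot> b) \<triangleright> (m \<triangleleft> c) + a \<triangleright> (b \<triangleright> (m \<triangleleft> c)))
    - ((a \<triangleright> (m \<triangleleft> b)) \<triangleleft> c - a \<triangleright> ((m \<triangleleft> b) \<triangleleft> c) - (a \<cdot> c) \<triangleright> (m \<triangleleft> b) + a \<triangleright> (c \<triangleright> (m \<triangleleft> b)))"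
    unfolding rsym_d2_def phi_cochain_def comm by (simp add: algebra_simps)
  then show ?thesis
    by (simp only: lact_ract diff_0_right)
qed

lemma linear_ract: "Vector_Spaces.linear sA sM (\<lambda>a. m \<triangleleft> a)"
  using ract_bilinear unfolding bilinear_over_def by blast

lemma psi_cochain_eq_phi_minus_d1:
  "psi_cochain (\<cdot>) (\<triangleleft>) m =
     (\<lambda>a b. phi_cochain (\<triangleright>) (\<triangleleft>) m a b - rsym_d1 (\<cdot>) (\<triangleright>) (\<triangleleft>) (\<lambda>x. m \<triangleleft> x) a b)"
  by (simp add: fun_eq_iff psi_cochain_def phi_cochain_def rsym_d1_def)

lemma rsym_d2_psi_cochain: "rsym_d2 (\<cdot>) (\<triangleright>) (\<triangleleft>) (psi_cochain (\<cdot>) (\<triangleleft>) m) a b c = 0"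
  by (simp add: psi_cochain_eq_phi_minus_d1 rsym_d2_diff rsym_d2_phi_cochain
      rsym_d2_d1[OF linear_ract])

lemma psi_cochain_sym: "psi_cochain (\<cdot>) (\<triangleleft>) m a b = psi_cochain (\<cdot>) (\<triangleleft>) m b a"
  using ract_commutator[of m a b]
  by (simp add: psi_cochain_def commutator_def ract_diff_right algebra_simps)

lemma bilinear_psi_cochain: "bilinear_over sA sA sM (psi_cochain (\<cdot>) (\<triangleleft>) m)"
  using vector_space_axioms M.vector_space_axioms
  by (simp add: bilinear_over_iff psi_cochain_def mul_add_left mul_scale_left mul_add_right
      mul_scale_right ract_add_left ract_scale_left ract_add_right ract_scale_right
      M.scale_right_diff_distrib)

lemma bilinear_phi_cochain: "bilinear_over sA sA sM (phi_cochain (\<triangleright>) (\<triangleleft>) m)"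
  using vector_space_axioms M.vector_space_axioms
  by (simp add: bilinear_over_iff phi_cochain_def lact_add_left lact_scale_left lact_add_right
      lact_scale_right ract_add_right ract_scale_right)

lemma zero_in_rsym_C1:
  assumes "M.subspace M"
  shows "(\<lambda>_. 0) \<in> rsym_C1 sA sM M"
  using assms vector_space_axioms M.vector_space_axioms
  by (simp add: rsym_C1_def Vector_Spaces.linear_iff M.subspace_0)

lemma diff_in_rsym_C1:
  assumes "M.subspace M" "\<omega> \<in> rsym_C1 sA sM M" "\<eta> \<in> rsym_C1 sA sM M"
  shows "(\<lambda>a. \<omega> a - \<eta> a) \<in> rsym_C1 sA sM M"
  using assms
  by (simp add: rsym_C1_def Vector_Spaces.linear_iff M.subspace_diff M.scale_right_diff_distrib
      add_diff_add)

lemma zero_in_rsym_B2: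
  assumes "M.subspace M"
  shows "(\<lambda>_ _. 0) \<in> rsym_B2 sA (\<cdot>) sM (\<triangleright>) (\<triangleleft>) M"
  unfolding rsym_B2_def
  by (rule image_eqI) (rule rsym_d1_zero[symmetric], rule zero_in_rsym_C1[OF assms])

lemma diff_in_rsym_B2:
  assumes "M.subspace M"
    and "\<beta> \<in> rsym_B2 sA (\<cdot>) sM (\<triangleright>) (\<triangleleft>) M" "\<gamma> \<in> rsym_B2 sA (\<cdot>) sM (\<triangleright>) (\<triangleleft>) M"
  shows "(\<lambda>a b. \<beta> a b - \<gamma> a b) \<in> rsym_B2 sA (\<cdot>) sM (\<triangleright>) (\<triangleleft>) M"
proof -
  obtain \<omega> \<eta> where "\<omega> \<in> rsym_C1 sA sM M" "\<eta> \<in> rsym_C1 sA sM M"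
    and eqs: "\<beta> = rsym_d1 (\<cdot>) (\<triangleright>) (\<triangleleft>) \<omega>" "\<gamma> = rsym_d1 (\<cdot>) (\<triangleright>) (\<triangleleft>) \<eta>"
    using assms(2,3) unfolding rsym_B2_def by blast
  then have "(\<lambda>a. \<omega> a - \<eta> a) \<in> rsym_C1 sA sM M"
    using assms(1) diff_in_rsym_C1 by blast
  moreover have "(\<lambda>a b. \<beta> a b - \<gamma> a b) = rsym_d1 (\<cdot>) (\<triangleright>) (\<triangleleft>) (\<lambda>a. \<omega> a - \<eta> a)"
    by (simp add: fun_eq_iff eqs rsym_d1_diff)
  ultimately show ?thesis
    unfolding rsym_B2_def by blast
qed

lemma equiv_rsym_cohomologous:
  assumes "M.subspace M"
  shows "equiv (rsym_Z2 sA (\<cdot>) sM (\<triangleright>) (\<triangleleft>) M) (rsym_cohomologous sA (\<cdot>) sM (\<triangleright>) (\<triangleleft>) M)"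
proof -
  let ?B = "rsym_B2 sA (\<cdot>) sM (\<triangleright>) (\<triangleleft>) M"
  have swap: "(\<lambda>a b. \<chi> a b - \<psi> a b) \<in> ?B" if "(\<lambda>a b. \<psi> a b - \<chi> a b) \<in> ?B" for \<psi> \<chi>
    using diff_in_rsym_B2[OF assms zero_in_rsym_B2[OF assms] that] by simp
  have join: "(\<lambda>a b. \<psi> a b - \<theta> a b) \<in> ?B"
    if "(\<lambda>a b. \<psi> a b - \<chi> a b) \<in> ?B" "(\<lambda>a b. \<chi> a b - \<theta> a b) \<in> ?B" for \<psi> \<chi> \<theta>
    using diff_in_rsym_B2[OF assms that(1) swap[OF that(2)]] by simp
  show ?thesis
  proof (rule equivI)
    show "refl_on (rsym_Z2 sA (\<cdot>) sM (\<triangleright>) (\<triangleleft>) M) (rsym_cohomologous sA (\<cdot>) sM (\<triangleright>) (\<triangleleft>) M)"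
      by (rule refl_onI) (simp add: rsym_cohomologous_def zero_in_rsym_B2[OF assms])
    show "rsym_cohomologous sA (\<cdot>) sM (\<triangleright>) (\<triangleleft>) M
            \<subseteq> rsym_Z2 sA (\<cdot>) sM (\<triangleright>) (\<triangleleft>) M \<times> rsym_Z2 sA (\<cdot>) sM (\<triangleright>) (\<triangleleft>) M"
      unfolding rsym_cohomologous_def by blast
    show "sym (rsym_cohomologous sA (\<cdot>) sM (\<triangleright>) (\<triangleleft>) M)"
      by (rule symI) (simp add: rsym_cohomologous_def swap)
    show "trans (rsym_cohomologous sA (\<cdot>) sM (\<triangleright>) (\<triangleleft>) M)"
      by (rule transI) (simp add: rsym_cohomologous_def, metis (lifting) join)
  qed
qed

lemma psi_cochain_cohomologous_phi_cochain:
  assumes "rsym_submodule sM (\<triangleright>) (\<triangleleft>) M" "\<And>a. m \<triangleleft> a \<in> M"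
  shows "(psi_cochain (\<cdot>) (\<triangleleft>) m, phi_cochain (\<triangleright>) (\<triangleleft>) m)
           \<in> rsym_cohomologous sA (\<cdot>) sM (\<triangleright>) (\<triangleleft>) M"
proof -
  let ?\<omega> = "\<lambda>a. m \<triangleleft> a"
  have sub: "M.subspace M" and closed: "x \<in> M \<Longrightarrow> a \<triangleright> x \<in> M \<and> x \<triangleleft> a \<in> M" for x a
    using assms(1) unfolding rsym_submodule_def by blast+
  have psi_Z2: "psi_cochain (\<cdot>) (\<triangleleft>) m \<in> rsym_Z2 sA (\<cdot>) sM (\<triangleright>) (\<triangleleft>) M"
    using sub closed assms(2) bilinear_psi_cochain rsym_d2_psi_cochain
    by (simp add: rsym_Z2_def rsym_C2_def psi_cochain_def M.subspace_diff)
  have phi_Z2: "phi_cochain (\<triangleright>) (\<triangleleft>) m \<in> rsym_Z2 sA (\<cdot>) sM (\<triangleright>) (\<triangleleft>) M"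
    using closed assms(2) bilinear_phi_cochain rsym_d2_phi_cochain
    by (simp add: rsym_Z2_def rsym_C2_def phi_cochain_def)
  have "?\<omega> \<in> rsym_C1 sA sM M"
    using linear_ract assms(2) by (simp add: rsym_C1_def)
  then have "rsym_d1 (\<cdot>) (\<triangleright>) (\<triangleleft>) ?\<omega> \<in> rsym_B2 sA (\<cdot>) sM (\<triangleright>) (\<triangleleft>) M"
    unfolding rsym_B2_def by blast
  \<comment> \<open>The difference of the two cocycles is \<open>0 - d\<^sub>1 \<omega>\<close>.\<close>
  from diff_in_rsym_B2[OF sub zero_in_rsym_B2[OF sub] this] psi_Z2 phi_Z2 show ?thesis
    by (simp add: rsym_cohomologous_def psi_cochain_eq_phi_minus_d1)
qed

end

theorem proposition5p1:
  fixes sA :: "'k::field \<Rightarrow> 'a::ab_group_add \<Rightarrow> 'a"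
    and mul :: "'a \<Rightarrow> 'a \<Rightarrow> 'a"  (infixl \<open>\<cdot>\<close> 70)
    and sM :: "'k \<Rightarrow> 'm::ab_group_add \<Rightarrow> 'm"
    and lact :: "'a \<Rightarrow> 'm \<Rightarrow> 'm"  (infixl \<open>\<triangleright>\<close> 70)
    and ract :: "'m \<Rightarrow> 'a \<Rightarrow> 'm"  (infixl \<open>\<triangleleft>\<close> 70)
    and M :: "'m set"
    and m :: 'm
  assumes "right_symmetric_algebra sA mul"
    and "right_symmetric_module sA mul sM lact ract"
    and "rsym_submodule sM lact ract M"
    and "\<forall>a b. m \<triangleleft> (a \<cdot> b) - (m \<triangleleft> a) \<triangleleft> b \<in> M"
  shows
    "psi_cochain mul ract m \<in> rsym_C2 sA sM M
     \<and> (\<forall>a b. psi_cochain mul ract m a b = psi_cochain mul ract m b a)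
     \<and> (\<forall>a b c. rsym_d2 mul lact ract (psi_cochain mul ract m) a b c = 0)
     \<and> ((\<forall>a. m \<triangleleft> a \<in> M) \<longrightarrow>
          phi_cochain lact ract m \<in> rsym_Z2 sA mul sM lact ract M
          \<and> rsym_class sA mul sM lact ract M (psi_cochain mul ract m)
              \<in> rsym_H2 sA mul sM lact ract M
          \<and> rsym_class sA mul sM lact ract M (psi_cochain mul ract m)
              = rsym_class sA mul sM lact ract M (phi_cochain lact ract m))"
proof -
  interpret right_symmetric_module sA mul sM lact ract
    by (rule assms(2))
  let ?\<psi> = "psi_cochain mul ract m" and ?\<phi> = "phi_cochain lact ract m"
  let ?Z = "rsym_Z2 sA mul sM lact ract M"
  let ?cls = "rsym_class sA mul sM lact ract M"
  have "?\<psi> \<in> rsym_C2 sA sM M"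
    using bilinear_psi_cochain assms(4) by (simp add: rsym_C2_def psi_cochain_def)
  moreover have "?\<phi> \<in> ?Z \<and> ?cls ?\<psi> \<in> rsym_H2 sA mul sM lact ract M \<and> ?cls ?\<psi> = ?cls ?\<phi>"
    if "\<forall>a. m \<triangleleft> a \<in> M"
  proof -
    have cohom: "(?\<psi>, ?\<phi>) \<in> rsym_cohomologous sA mul sM lact ract M"
      using psi_cochain_cohomologous_phi_cochain assms(3) that by blast
    then have "?\<psi> \<in> ?Z" "?\<phi> \<in> ?Z"
      by (auto simp: rsym_cohomologous_def)
    moreover have "equiv ?Z (rsym_cohomologous sA mul sM lact ract M)"
      using assms(3) equiv_rsym_cohomologous unfolding rsym_submodule_def by blast
    ultimately show ?thesis
      using equiv_class_eq[OF _ cohom] by (simp add: rsym_class_def rsym_H2_def quotientI)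
  qed
  ultimately show ?thesis
    using psi_cochain_sym rsym_d2_psi_cochain by blast
qed

end
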